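(* Let $G=(V,E)$ be a finite graph, let $k$ be an integer, and let $\tau$ be a $k$-tangle in $G$. Then there exists a function $w\colon V\to\mathbb{N}$ such that for every separation $(A,B)$ of $G$ of order $<k$ we have $(A,B)\in\tau$ if and only if $w(A)<w(B)$, where $w(U):=\sum_{u\in U}w(u)$ for $U\subseteq V$.
   Context: A separation of a graph $G=(V,E)$ is a pair $(A,B)$ of subsets of $V$ with $A\cup B=V$ such that $G$ has no edge between $A\setminus B$ and $B\setminus A$; its order is $|A\cap B|$. For an integer $k$, a $k$-tangle in $G$ is a set $\tau$ of separations of $G$ containing exactly one of $(A,B)$ and $(B,A)$ for every separation $(A,B)$ of $G$ of order $<k$ (and no other separations), such that there are no $(A_1,B_1),(A_2,B_2),(A_3,B_3)\in\tau$ (not necessarily distinct) with $G=G[A_1]\cup G[A_2]\cup G[A_3]$. *)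

theory Defs
  imports "Graph_Theory.Digraph_Component"
begin

text \<open>
  A finite simple graph is a digraph satisfying the locale predicate \<^const>\<open>graph\<close>: it is finite,
  loop-free, has no parallel arcs, and an edge \<open>uv\<close> is represented by the two arcs from \<open>u\<close> to \<open>v\<close>
  and from \<open>v\<close> to \<open>u\<close>. The induced subgraph \<open>G[A]\<close> is \<open>G \<restriction> A\<close>.
\<close>

definition separation :: "('a, 'b) pre_digraph \<Rightarrow> 'a set \<Rightarrow> 'a set \<Rightarrow> bool" where
  "separation G A B \<longleftrightarrow>
     A \<subseteq> verts G \<and> B \<subseteq> verts G \<and> A \<union> B = verts G \<and>
     (\<forall>a \<in> A - B. \<forall>b \<in> B - A. \<not> a \<rightarrow>\<^bsub>G\<^esub> b \<and> \<not> b \<rightarrow>\<^bsub>G\<^esub> a)"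

definition sep_order :: "'a set \<Rightarrow> 'a set \<Rightarrow> nat" where
  "sep_order A B = card (A \<inter> B)"

definition tangle :: "('a, 'b) pre_digraph \<Rightarrow> int \<Rightarrow> ('a set \<times> 'a set) set \<Rightarrow> bool" where
  "tangle G k \<tau> \<longleftrightarrow>
     (\<forall>(A, B) \<in> \<tau>. separation G A B \<and> int (sep_order A B) < k) \<and>
     (\<forall>A B. separation G A B \<and> int (sep_order A B) < k \<longrightarrow> (\<exists>!s. s \<in> {(A, B), (B, A)} \<and> s \<in> \<tau>)) \<and>
     \<not> (\<exists>A\<^sub>1 B\<^sub>1 A\<^sub>2 B\<^sub>2 A\<^sub>3 B\<^sub>3. (A\<^sub>1, B\<^sub>1) \<in> \<tau> \<and> (A\<^sub>2, B\<^sub>2) \<in> \<tau> \<and> (A\<^sub>3, B\<^sub>3) \<in> \<tau> \<and>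
          G = union (union (G \<restriction> A\<^sub>1) (G \<restriction> A\<^sub>2)) (G \<restriction> A\<^sub>3))"

end

theory Submission
  imports Defs "HOL-Library.Indicator_Function"
begin

text \<open>
  It suffices to find \<open>w\<close> with \<open>w(A) < w(B)\<close> for the maximal elements \<open>(A\<^sub>i, B\<^sub>i)\<close> of \<open>\<tau>\<close>. If there is
  none, linear duality gives weights \<open>y\<^sub>i \<ge> 0\<close>, not all zero, such that the function
  \<open>x = (\<Sum>\<^sub>i y\<^sub>i (1\<^bsub>B\<^sub>i\<^esub> - 1\<^bsub>A\<^sub>i\<^esub>))\<close> is nowhere positive. Summing \<open>x\<close> over the separator of
  \<open>(A\<^sub>j, B\<^sub>j)\<close> with weight \<open>y\<^sub>j\<close> gives a quadratic form in \<open>y\<close> which is at most \<open>0\<close>. Its diagonal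
  vanishes, and the symmetrised coefficient at \<open>i \<noteq> j\<close> is the order of the supremum minus the order
  of the infimum of the two separations. That is positive: by maximality and the tangle axioms the
  supremum has order at least \<open>k\<close>, so by submodularity the infimum has order less than \<open>k\<close>. Hence
  only one \<open>y\<^sub>i\<close> is nonzero, so \<open>B\<^sub>i \<subseteq> A\<^sub>i = V\<close>, which no tangle allows.
\<close>

section \<open>Positive solutions of linear inequalities\<close>

text \<open>Supplies the value of the variable eliminated below: \<open>A\<close> collects its lower
  bounds and \<open>B\<close> its upper bounds, of which there may be none.\<close>

lemma finite_sets_separated:
  fixes A B :: "real set"
  assumes "finite A" "finite B" "A \<noteq> {}" and less: "\<And>a b. a \<in> A \<Longrightarrow> b \<in> B \<Longrightarrow> a < b"
  shows "\<exists>t. (\<forall>a\<in>A. a < t) \<and> (\<forall>b\<in>B. t < b)"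
proof (cases "B = {}")
  case True
  have "\<forall>a\<in>A. a < Max A + 1"
    using assms(1) Max_ge by (metis less_add_one order_le_less_trans)
  then show ?thesis using True by blast
next
  case False
  then have "Max A < Min B"
    using assms by (intro less) auto
  then obtain t where "Max A < t" "t < Min B"
    using dense by blast
  then show ?thesis
    using assms False by (intro exI[of _ t]) simp
qed

text \<open>The induction over \<open>V\<close> is Fourier--Motzkin elimination of one weight at a time.\<close>

lemma positive_solution_exists:
  fixes R C :: "('v \<Rightarrow> real) set"
  assumes "finite V" "finite R" "R \<subseteq> C"
    and "\<And>x y. x \<in> C \<Longrightarrow> y \<in> C \<Longrightarrow> (\<lambda>v. x v + y v) \<in> C"
    and "\<And>a x. 0 < a \<Longrightarrow> x \<in> C \<Longrightarrow> (\<lambda>v. a * x v) \<in> C"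
    and "\<And>x. x \<in> C \<Longrightarrow> \<exists>v\<in>V. 0 < x v"
  shows "\<exists>w. (\<forall>v\<in>V. 0 \<le> w v) \<and> (\<forall>r\<in>R. 0 < (\<Sum>v\<in>V. w v * r v))"
  using assms
proof (induction V arbitrary: R C rule: finite_induct)
  case empty
  then have "R = {}" by fastforce
  then show ?case by simp
next
  case (insert u V)
  note add = insert.prems(3) and scale = insert.prems(4) and pos = insert.prems(5)
  \<comment> \<open>For \<open>p u > 0 > n u\<close> both coefficients are positive, and the
    combination vanishes at \<open>u\<close>.\<close>
  define comb where "comb = (\<lambda>(p :: 'v \<Rightarrow> real, n :: 'v \<Rightarrow> real) v. p u * n v + (- n u) * p v)"
  define P where "P = {r \<in> R. 0 < r u}"
  define N where "N = {r \<in> R. r u < 0}"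
  \<comment> \<open>Besides the combinations, the inequalities with \<open>r u < 0\<close> are kept
    themselves. This amounts to pairing them with the extra lower bound 0 on the weight of
    \<open>u\<close>.\<close>
  define R' where "R' = {r \<in> R. r u \<le> 0} \<union> comb ` (P \<times> N)"
  \<comment> \<open>An element of \<open>C\<close> with \<open>x u \<le> 0\<close> must have its
    positive coordinate in \<open>V\<close>, so the cone hypothesis survives the elimination of
    \<open>u\<close>.\<close>
  define C' where "C' = {x \<in> C. x u \<le> 0}"
  have fin: "finite P" "finite N"
    using insert.prems(1) by (auto simp: P_def N_def)
  have comb_in: "comb (p, n) \<in> C'" if "p \<in> P" "n \<in> N" for p n
  proof -
    have "comb (p, n) \<in> C"
      using that insert.prems(2) unfolding comb_def P_def N_def case_prod_conv
      by (intro add scale) auto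
    then show ?thesis by (simp add: C'_def comb_def)
  qed
  have "\<exists>w. (\<forall>v\<in>V. 0 \<le> w v) \<and> (\<forall>r\<in>R'. 0 < (\<Sum>v\<in>V. w v * r v))"
  proof (rule insert.IH)
    show "finite R'"
      using insert.prems(1) fin by (simp add: R'_def)
    show "R' \<subseteq> C'"
      using insert.prems(2) comb_in by (auto simp: R'_def C'_def)
    show "\<And>x y. x \<in> C' \<Longrightarrow> y \<in> C' \<Longrightarrow> (\<lambda>v. x v + y v) \<in> C'"
      using add by (auto simp: C'_def)
    show "\<And>a x. 0 < a \<Longrightarrow> x \<in> C' \<Longrightarrow> (\<lambda>v. a * x v) \<in> C'"
      using scale by (auto simp: C'_def mult_le_0_iff)
    show "\<And>x. x \<in> C' \<Longrightarrow> \<exists>v\<in>V. 0 < x v"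
      using pos by (force simp: C'_def)
  qed
  then obtain w where w0: "\<forall>v\<in>V. 0 \<le> w v" and w: "\<forall>r\<in>R'. 0 < (\<Sum>v\<in>V. w v * r v)"
    by blast
  define S where "S = (\<lambda>r. \<Sum>v\<in>V. w v * r v)"
  have S_comb: "S (comb (p, n)) = p u * S n - n u * S p" for p n
    by (simp add: S_def comb_def sum_distrib_left sum_subtractf sum.distrib algebra_simps)
  \<comment> \<open>Solving \<open>0 < t * r u + S r\<close> for the new weight \<open>t\<close>
    gives a lower bound if \<open>r u > 0\<close> and an upper bound if \<open>r u < 0\<close>; the
    element 0 of \<open>L\<close> makes \<open>t\<close> positive.\<close>
  define L where "L = insert 0 ((\<lambda>p. - S p / p u) ` P)"
  define U where "U = (\<lambda>n. S n / (- n u)) ` N"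
  have "\<exists>t. (\<forall>a\<in>L. a < t) \<and> (\<forall>b\<in>U. t < b)"
  proof (rule finite_sets_separated)
    fix a b assume a: "a \<in> L" and b: "b \<in> U"
    from b obtain n where n: "n \<in> N" "b = S n / (- n u)" by (auto simp: U_def)
    then have nu: "n u < 0" by (simp add: N_def)
    have "0 < S n" using w n(1) by (auto simp: S_def R'_def N_def)
    then have b0: "0 < b" using nu n(2) by (simp add: divide_less_0_iff)
    show "a < b"
    proof (cases "a = 0")
      case True
      then show ?thesis using b0 by simp
    next
      case False
      then obtain p where p: "p \<in> P" "a = - S p / p u" using a by (auto simp: L_def)
      then have pu: "0 < p u" by (simp add: P_def)
      have "comb (p, n) \<in> R'" using p(1) n(1) by (auto simp: R'_def)
      then have "0 < p u * S n - n u * S p" using w S_comb S_def by metis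
      then show ?thesis
        unfolding p(2) n(2) using pu nu by (simp add: field_simps)
    qed
  qed (use fin in \<open>auto simp: L_def U_def\<close>)
  then obtain t where tL: "\<forall>a\<in>L. a < t" and tU: "\<forall>b\<in>U. t < b" by blast
  have "0 < t" using tL by (simp add: L_def)
  have "0 < t * r u + S r" if r: "r \<in> R" for r
  proof -
    consider "r \<in> P" | "r \<in> N" | "r u = 0" using r by (force simp: P_def N_def)
    then show ?thesis
    proof cases
      case 1
      then have "- S r / r u < t" "0 < r u" using tL by (auto simp: L_def P_def)
      then show ?thesis by (simp add: field_simps)
    next
      case 2
      then have "t < S r / (- r u)" "r u < 0" using tU by (auto simp: U_def N_def)
      then show ?thesis by (simp add: field_simps)
    next
      case 3
      then show ?thesis using w r by (auto simp: S_def R'_def)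
    qed
  qed
  moreover have "(\<Sum>v\<in>insert u V. (w(u := t)) v * r v) = t * r u + S r" for r
  proof -
    have "(\<Sum>v\<in>V. (w(u := t)) v * r v) = S r"
      unfolding S_def using insert.hyps(2) by (intro sum.cong) auto
    then show ?thesis using insert.hyps by simp
  qed
  ultimately show ?case
    using w0 \<open>0 < t\<close> by (intro exI[of _ "w(u := t)"]) auto
qed

text \<open>Scale by a large \<open>N\<close> and round down: the rounding changes the value at
  \<open>r\<close> by at most the sum \<open>D r\<close> of the absolute values of \<open>r\<close>,
  while the scaled value \<open>N * S r\<close> exceeds \<open>D r\<close>.\<close>

lemma positive_solution_nat:
  fixes R :: "('v \<Rightarrow> real) set"
  assumes "finite R" and w0: "\<forall>v\<in>V. 0 \<le> w v" and w: "\<forall>r\<in>R. 0 < (\<Sum>v\<in>V. w v * r v)"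
  shows "\<exists>w' :: 'v \<Rightarrow> nat. \<forall>r\<in>R. 0 < (\<Sum>v\<in>V. real (w' v) * r v)"
proof -
  define S where "S = (\<lambda>r. \<Sum>v\<in>V. w v * r v)"
  define D where "D = (\<lambda>r :: 'v \<Rightarrow> real. \<Sum>v\<in>V. \<bar>r v\<bar>)"
  \<comment> \<open>The sum of these nonnegative ratios bounds each of them, so one \<open>N\<close>
    serves all of \<open>R\<close>.\<close>
  obtain N where N: "(\<Sum>r\<in>R. D r / S r) < real N"
    using reals_Archimedean2 by blast
  define w' where "w' = (\<lambda>v. nat \<lfloor>real N * w v\<rfloor>)"
  have "0 < (\<Sum>v\<in>V. real (w' v) * r v)" if r: "r \<in> R" for r
  proof -
    have Sr: "0 < S r" using w r by (simp add: S_def)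
    have "D r / S r \<le> (\<Sum>r\<in>R. D r / S r)"
      using r assms(1) w by (intro member_le_sum) (auto simp: D_def S_def sum_nonneg less_imp_le)
    then have "D r < real N * S r"
      using N Sr by (smt (verit) pos_divide_less_eq)
    also have "real N * S r - (\<Sum>v\<in>V. real (w' v) * r v) = (\<Sum>v\<in>V. (real N * w v - real (w' v)) * r v)"
      by (simp add: S_def sum_distrib_left sum_subtractf algebra_simps)
    then have "real N * S r = (\<Sum>v\<in>V. real (w' v) * r v) + (\<Sum>v\<in>V. (real N * w v - real (w' v)) * r v)"
      by simp
    also have "(\<Sum>v\<in>V. (real N * w v - real (w' v)) * r v) \<le> D r"
      unfolding D_def
    proof (rule sum_mono)
      fix v assume "v \<in> V"
      then have "0 \<le> real N * w v" using w0 by simp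
      then have "\<bar>real N * w v - real (w' v)\<bar> \<le> 1"
        unfolding w'_def by linarith
      then have "\<bar>(real N * w v - real (w' v)) * r v\<bar> \<le> \<bar>r v\<bar>"
        by (simp add: abs_mult mult_left_le_one_le)
      then show "(real N * w v - real (w' v)) * r v \<le> \<bar>r v\<bar>" by linarith
    qed
    finally show ?thesis by simp
  qed
  then show ?thesis by blast
qed

text \<open>Twice the form is the sum of all \<open>y i * y j * (m i j + m j i)\<close>. These terms
  are nonnegative, and two distinct indices in the support of \<open>y\<close> would make one of
  them positive.\<close>

lemma quadratic_form_singleton_support:
  fixes y :: "'i \<Rightarrow> real" and m :: "'i \<Rightarrow> 'i \<Rightarrow> real"
  assumes "finite M" and y: "\<And>i. i \<in> M \<Longrightarrow> 0 \<le> y i"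
    and diag: "\<And>i. i \<in> M \<Longrightarrow> m i i = 0"
    and off: "\<And>i j. i \<in> M \<Longrightarrow> j \<in> M \<Longrightarrow> i \<noteq> j \<Longrightarrow> 0 < m i j + m j i"
    and le: "(\<Sum>i\<in>M. \<Sum>j\<in>M. y i * y j * m i j) \<le> 0"
    and ij: "i \<in> M" "j \<in> M" "0 < y i" "0 < y j"
  shows "i = j"
proof (rule ccontr)
  assume "i \<noteq> j"
  let ?f = "\<lambda>i j. y i * y j * (m i j + m j i)"
  have nonneg: "0 \<le> ?f a b" if "a \<in> M" "b \<in> M" for a b
  proof (cases "a = b")
    case True
    then show ?thesis using that diag by simp
  next
    case False
    then show ?thesis by (intro mult_nonneg_nonneg y less_imp_le[OF off[OF that]] that)
  qed
  have "0 < ?f i j"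
    using ij off \<open>i \<noteq> j\<close> by simp
  also have "\<dots> \<le> (\<Sum>b\<in>M. ?f i b)"
    using assms(1) ij nonneg by (intro member_le_sum) auto
  also have "\<dots> \<le> (\<Sum>a\<in>M. \<Sum>b\<in>M. ?f a b)"
    using assms(1) ij nonneg
    by (intro member_le_sum[where f = "\<lambda>a. \<Sum>b\<in>M. ?f a b"]) (auto intro!: sum_nonneg)
  also have "\<dots> = (\<Sum>a\<in>M. \<Sum>b\<in>M. y a * y b * m a b) + (\<Sum>a\<in>M. \<Sum>b\<in>M. y a * y b * m b a)"
    by (simp add: sum.distrib distrib_left)
  also have "(\<Sum>a\<in>M. \<Sum>b\<in>M. y a * y b * m b a) = (\<Sum>a\<in>M. \<Sum>b\<in>M. y a * y b * m a b)"
    by (subst sum.swap) (simp add: mult_ac)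
  finally show False using le by simp
qed

section \<open>Tangles\<close>

lemma separation_arc:
  assumes "wf_digraph G" "separation G A B" "e \<in> arcs G"
  shows "tail G e \<in> A \<and> head G e \<in> A \<or> tail G e \<in> B \<and> head G e \<in> B"
proof -
  interpret wf_digraph G by fact
  have "tail G e \<rightarrow>\<^bsub>G\<^esub> head G e" "tail G e \<in> A \<union> B" "head G e \<in> A \<union> B"
    using assms by (auto simp: separation_def arcs_ends_def arc_to_ends_def)
  then show ?thesis
    using assms(2) unfolding separation_def by blast
qed

text \<open>Induced subgraphs and unions inherit the tail and head maps of \<open>G\<close>, so it
  is enough to cover its vertices and arcs.\<close>

lemma eq_union_induced:
  assumes "A \<union> B \<union> C = verts G"
    and "\<And>e. e \<in> arcs G \<Longrightarrow> {tail G e, head G e} \<subseteq> A \<or> {tail G e, head G e} \<subseteq> B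
      \<or> {tail G e, head G e} \<subseteq> C"
  shows "G = union (union (G \<restriction> A) (G \<restriction> B)) (G \<restriction> C)"
  using assms by (intro pre_digraph.equality) auto

lemma separation_sup:
  assumes "separation G A B" "separation G A' B'"
  shows "separation G (A \<union> A') (B \<inter> B')"
  using assms unfolding separation_def by blast

lemma tangle_cover:
  assumes "tangle G k \<tau>" "(A, B) \<in> \<tau>" "(A', B') \<in> \<tau>" "(A'', B'') \<in> \<tau>"
  shows "G \<noteq> union (union (G \<restriction> A) (G \<restriction> A')) (G \<restriction> A'')"
proof
  assume "G = union (union (G \<restriction> A) (G \<restriction> A')) (G \<restriction> A'')"
  with assms(2-4) have "\<exists>A\<^sub>1 B\<^sub>1 A\<^sub>2 B\<^sub>2 A\<^sub>3 B\<^sub>3. (A\<^sub>1, B\<^sub>1) \<in> \<tau> \<and> (A\<^sub>2, B\<^sub>2) \<in> \<tau> \<and> (A\<^sub>3, B\<^sub>3) \<in> \<tau> \<and>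
      G = union (union (G \<restriction> A\<^sub>1) (G \<restriction> A\<^sub>2)) (G \<restriction> A\<^sub>3)"
    by (intro exI conjI)
  then show False
    using assms(1) unfolding tangle_def by (elim conjE notE)
qed

lemma tangleD:
  assumes "tangle G k \<tau>" "(A, B) \<in> \<tau>"
  shows "separation G A B" "int (sep_order A B) < k"
proof -
  have "\<forall>(A, B) \<in> \<tau>. separation G A B \<and> int (sep_order A B) < k"
    using assms(1) unfolding tangle_def by (elim conjE)
  then show "separation G A B" "int (sep_order A B) < k"
    using assms(2) by auto
qed

lemma tangle_total:
  assumes "tangle G k \<tau>" "separation G A B" "int (sep_order A B) < k"
  shows "(A, B) \<in> \<tau> \<or> (B, A) \<in> \<tau>"
proof -
  have "\<forall>A B. separation G A B \<and> int (sep_order A B) < k \<longrightarrow> (\<exists>!s. s \<in> {(A, B), (B, A)} \<and> s \<in> \<tau>)"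
    using assms(1) unfolding tangle_def by (elim conjE)
  then have "\<exists>s. s \<in> {(A, B), (B, A)} \<and> s \<in> \<tau>"
    using assms(2,3) by (meson ex1_implies_ex)
  then show ?thesis by auto
qed

text \<open>Otherwise \<open>A\<close> is the whole vertex set, and \<open>(A, B)\<close> taken
  three times covers \<open>G\<close>.\<close>

lemma tangle_not_subset:
  assumes "wf_digraph G" "tangle G k \<tau>" "(A, B) \<in> \<tau>"
  shows "\<not> B \<subseteq> A"
proof
  interpret wf_digraph G by fact
  assume "B \<subseteq> A"
  then have "A = verts G"
    using tangleD(1)[OF assms(2,3)] by (auto simp: separation_def)
  then have "G = union (union (G \<restriction> A) (G \<restriction> A)) (G \<restriction> A)"
    by (intro eq_union_induced) auto
  then show False
    using tangle_cover[OF assms(2,3,3,3)] by blast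
qed

text \<open>If the tangle contained the reverse of the supremum, then \<open>A\<close>,
  \<open>A'\<close> and \<open>B \<inter> B'\<close> would cover \<open>G\<close>: an arc inside
  neither \<open>A\<close> nor \<open>A'\<close> has both ends in \<open>B\<close> and both in
  \<open>B'\<close>.\<close>

lemma tangle_sup:
  assumes "wf_digraph G" "tangle G k \<tau>" "(A, B) \<in> \<tau>" "(A', B') \<in> \<tau>"
    and ord: "int (sep_order (A \<union> A') (B \<inter> B')) < k"
  shows "(A \<union> A', B \<inter> B') \<in> \<tau>"
proof (rule ccontr)
  assume "(A \<union> A', B \<inter> B') \<notin> \<tau>"
  note sep = tangleD(1)[OF assms(2,3)] tangleD(1)[OF assms(2,4)]
  have "(B \<inter> B', A \<union> A') \<in> \<tau>"
    using tangle_total[OF assms(2) separation_sup[OF sep] ord] \<open>_ \<notin> \<tau>\<close> by blast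
  moreover have "G = union (union (G \<restriction> A) (G \<restriction> A')) (G \<restriction> (B \<inter> B'))"
  proof (rule eq_union_induced)
    show "A \<union> A' \<union> B \<inter> B' = verts G"
      using sep by (auto simp: separation_def)
    fix e assume "e \<in> arcs G"
    then show "{tail G e, head G e} \<subseteq> A \<or> {tail G e, head G e} \<subseteq> A'
        \<or> {tail G e, head G e} \<subseteq> B \<inter> B'"
      using separation_arc[OF assms(1) sep(1)] separation_arc[OF assms(1) sep(2)] by blast
  qed
  ultimately show False
    using tangle_cover[OF assms(2-4)] by blast
qed

section \<open>Maximal separations of a tangle\<close>

definition maximal_seps :: "('a set \<times> 'a set) set \<Rightarrow> ('a set \<times> 'a set) set" where
  "maximal_seps \<tau> = {(A, B) \<in> \<tau>. \<forall>(A', B') \<in> \<tau>. A \<subseteq> A' \<and> B' \<subseteq> B \<longrightarrow> A' = A \<and> B' = B}"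

lemma maximal_sepsD:
  assumes "(A, B) \<in> maximal_seps \<tau>" "(A', B') \<in> \<tau>" "A \<subseteq> A'" "B' \<subseteq> B"
  shows "A' = A" "B' = B"
  using assms by (auto simp: maximal_seps_def)

text \<open>Reduces the theorem to maximal elements: a weight with \<open>w(A') < w(B')\<close> also
  satisfies \<open>w(A) \<le> w(A') < w(B') \<le> w(B)\<close>.\<close>

lemma ex_maximal_sep:
  assumes "finite V" "\<And>A B. (A, B) \<in> \<tau> \<Longrightarrow> A \<subseteq> V \<and> B \<subseteq> V" "(A, B) \<in> \<tau>"
  shows "\<exists>(A', B') \<in> maximal_seps \<tau>. A \<subseteq> A' \<and> B' \<subseteq> B"
  using assms(3)
\<comment> \<open>A strictly larger separation has a smaller \<open>V - A\<close> or a smaller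
  \<open>B\<close>.\<close>
proof (induction "card (V - A) + card B" arbitrary: A B rule: less_induct)
  case less
  show ?case
  proof (cases "(A, B) \<in> maximal_seps \<tau>")
    case True
    then show ?thesis by blast
  next
    case False
    then obtain A' B' where *: "(A', B') \<in> \<tau>" "A \<subseteq> A'" "B' \<subseteq> B" "A' \<noteq> A \<or> B' \<noteq> B"
      using less.prems by (auto simp: maximal_seps_def)
    have sub: "A' \<subseteq> V" "B \<subseteq> V" using assms(2) less.prems *(1) by blast+
    have fin: "finite (V - A)" "finite B" using assms(1) sub finite_subset by auto
    have "card (V - A') \<le> card (V - A)" "card B' \<le> card B"
      using * fin by (auto intro!: card_mono)
    moreover have "card (V - A') < card (V - A) \<or> card B' < card B"
      using * fin sub psubset_card_mono[of "V - A" "V - A'"] psubset_card_mono[of B B'] by blast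
    ultimately have "card (V - A') + card B' < card (V - A) + card B" by linarith
    from less.hyps[OF this *(1)] obtain A'' B''
      where "(A'', B'') \<in> maximal_seps \<tau>" "A' \<subseteq> A''" "B'' \<subseteq> B'" by auto
    then show ?thesis using *(2,3) by (intro bexI[of _ "(A'', B'')"]) auto
  qed
qed

text \<open>The right-hand side exceeds the left by the order of the supremum minus that of the infimum.\<close>

lemma maximal_seps_pair:
  assumes "graph G" "tangle G k \<tau>" "(A, B) \<in> maximal_seps \<tau>" "(A', B') \<in> maximal_seps \<tau>"
    and ne: "(A, B) \<noteq> (A', B')"
  shows "card (A' \<inter> B' \<inter> A) + card (A \<inter> B \<inter> A') < card (A' \<inter> B' \<inter> B) + card (A \<inter> B \<inter> B')"
proof -
  interpret graph G by fact
  have in_tau: "(A, B) \<in> \<tau>" "(A', B') \<in> \<tau>"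
    using assms(3,4) by (auto simp: maximal_seps_def)
  have fin: "finite A" "finite B" "finite A'" "finite B'"
    using tangleD(1)[OF assms(2)] in_tau finite_verts finite_subset
    unfolding separation_def by metis+
  \<comment> \<open>A supremum in the tangle would equal both maximal elements, which are
    distinct.\<close>
  have "(A \<union> A', B \<inter> B') \<notin> \<tau>"
  proof
    assume *: "(A \<union> A', B \<inter> B') \<in> \<tau>"
    have "A \<union> A' = A" "B \<inter> B' = B" "A \<union> A' = A'" "B \<inter> B' = B'"
      using maximal_sepsD[OF assms(3) *] maximal_sepsD[OF assms(4) *] by auto
    then show False using ne by simp
  qed
  then have sup: "k \<le> int (card ((A \<union> A') \<inter> (B \<inter> B')))"
    using tangle_sup[OF wf_digraph_axioms assms(2) in_tau] by (force simp: sep_order_def)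
  have ord: "int (card (A \<inter> B)) < k" "int (card (A' \<inter> B')) < k"
    using tangleD(2)[OF assms(2)] in_tau by (force simp: sep_order_def)+
  have cardI: "card X + card Y = card (X \<union> Y) + card (X \<inter> Y)" if "finite X" "finite Y" for X Y :: "'a set"
    using that by (rule card_Un_Int)
  let ?sup = "(A \<union> A') \<inter> (B \<inter> B')" and ?inf = "(A \<inter> A') \<inter> (B \<union> B')" and ?S = "A \<inter> B \<inter> (A' \<inter> B')"
  \<comment> \<open>The two sets unite to \<open>?sup\<close> and meet in \<open>?S\<close>. In the
    next step the union is \<open>?inf\<close> and the intersection again \<open>?S\<close>, which
    therefore cancels.\<close>
  have 1: "card (A' \<inter> B' \<inter> B) + card (A \<inter> B \<inter> B') = card ?sup + card ?S"
  proof -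
    have "A' \<inter> B' \<inter> B \<union> A \<inter> B \<inter> B' = ?sup" "A' \<inter> B' \<inter> B \<inter> (A \<inter> B \<inter> B') = ?S" by blast+
    then show ?thesis using fin cardI[of "A' \<inter> B' \<inter> B" "A \<inter> B \<inter> B'"] by simp
  qed
  have 2: "card (A' \<inter> B' \<inter> A) + card (A \<inter> B \<inter> A') = card ?inf + card ?S"
  proof -
    have "A' \<inter> B' \<inter> A \<union> A \<inter> B \<inter> A' = ?inf" "A' \<inter> B' \<inter> A \<inter> (A \<inter> B \<inter> A') = ?S" by blast+
    then show ?thesis using fin cardI[of "A' \<inter> B' \<inter> A" "A \<inter> B \<inter> A'"] by simp
  qed
  \<comment> \<open>Submodularity of the order: with \<open>sup\<close> and \<open>ord\<close> it
    forces \<open>card ?inf < k \<le> card ?sup\<close>.\<close>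
  have 3: "card (A \<inter> B) + card (A' \<inter> B') \<ge> card ?sup + card ?inf"
  proof -
    have "card ?sup + card ?inf = card (?sup \<union> ?inf) + card (?sup \<inter> ?inf)"
      using fin by (intro cardI) auto
    also have "\<dots> \<le> card (A \<inter> B \<union> A' \<inter> B') + card (A \<inter> B \<inter> (A' \<inter> B'))"
      using fin by (intro add_mono card_mono) auto
    also have "\<dots> = card (A \<inter> B) + card (A' \<inter> B')"
      using fin by (intro cardI[symmetric]) auto
    finally show ?thesis .
  qed
  show ?thesis using 1 2 3 sup ord by linarith
qed

text \<open>This is the cone hypothesis of \<open>positive_solution_exists\<close> for the cone
  generated by the vectors \<open>c s\<close>.\<close>

lemma maximal_seps_no_dual:
  fixes G :: "('a, 'b) pre_digraph" and y :: "'a set \<times> 'a set \<Rightarrow> real"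
  defines "c \<equiv> \<lambda>s v. indicator (snd s) v - indicator (fst s) v :: real"
  assumes "graph G" "tangle G k \<tau>"
    and y: "\<And>s. s \<in> maximal_seps \<tau> \<Longrightarrow> 0 \<le> y s" and ex: "\<exists>s\<in>maximal_seps \<tau>. 0 < y s"
    and finM: "finite (maximal_seps \<tau>)"
  shows "\<exists>v\<in>verts G. 0 < (\<Sum>s\<in>maximal_seps \<tau>. y s * c s v)"
proof (rule ccontr)
  interpret graph G by fact
  let ?M = "maximal_seps \<tau>"
  define x where "x = (\<lambda>v. \<Sum>s\<in>?M. y s * c s v)"
  define sp where "sp = (\<lambda>s. fst s \<inter> snd s :: 'a set)"
  assume "\<not> ?thesis"
  then have x: "x v \<le> 0" if "v \<in> verts G" for v
    using that by (force simp: x_def not_less)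
  have M_tau: "s \<in> ?M \<Longrightarrow> (fst s, snd s) \<in> \<tau>" for s
    by (auto simp: maximal_seps_def)
  have sub: "fst s \<subseteq> verts G" "snd s \<subseteq> verts G" if "s \<in> ?M" for s
    using tangleD(1)[OF assms(3) M_tau[OF that]] by (auto simp: separation_def)
  have fin: "finite (sp s)" if "s \<in> ?M" for s
    using sub[OF that] finite_subset[OF _ finite_verts] by (auto simp: sp_def)
  \<comment> \<open>The coefficient sums the vector of \<open>s\<close> over the separator of
    \<open>t\<close>; it is not symmetric in \<open>s\<close> and \<open>t\<close>.\<close>
  define m where "m = (\<lambda>s t. \<Sum>v\<in>sp t. c s v)"
  have m: "m s t = real (card (sp t \<inter> snd s)) - real (card (sp t \<inter> fst s))" if "t \<in> ?M" for s t
    using fin[OF that] by (simp add: m_def c_def sum_subtractf indicator_def sum.If_cases Int_def)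
  have le: "(\<Sum>s\<in>?M. \<Sum>t\<in>?M. y s * y t * m s t) \<le> 0"
  proof -
    have "(\<Sum>s\<in>?M. \<Sum>t\<in>?M. y s * y t * m s t) = (\<Sum>t\<in>?M. y t * (\<Sum>s\<in>?M. y s * m s t))"
      by (subst sum.swap) (simp add: sum_distrib_left mult_ac)
    also have "\<dots> = (\<Sum>t\<in>?M. y t * (\<Sum>v\<in>sp t. x v))"
    proof (intro sum.cong refl arg_cong2[where f = "(*)"])
      fix t
      show "(\<Sum>s\<in>?M. y s * m s t) = (\<Sum>v\<in>sp t. x v)"
        unfolding x_def m_def sum_distrib_left by (rule sum.swap)
    qed
    also have "\<dots> \<le> 0"
    proof (intro sum_nonpos mult_nonneg_nonpos y x)
      fix t v assume "t \<in> ?M" "v \<in> sp t"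
      then show "v \<in> verts G" using subsetD[OF sub(1)] by (simp add: sp_def)
    qed
    finally show ?thesis .
  qed
  \<comment> \<open>The separator of \<open>s\<close> lies in both sides of \<open>s\<close>, so the
    two counts agree.\<close>
  have diag: "m s s = 0" if "s \<in> ?M" for s
    using m[OF that, of s] by (simp add: sp_def Int_ac)
  have off: "0 < m s t + m t s" if "s \<in> ?M" "t \<in> ?M" "s \<noteq> t" for s t
    using maximal_seps_pair[OF assms(2,3), of "fst s" "snd s" "fst t" "snd t"] that
    by (simp add: m sp_def prod_eq_iff)
  obtain s where s: "s \<in> ?M" "0 < y s" using ex by blast
  have zero: "y t = 0" if "t \<in> ?M" "t \<noteq> s" for t
    using quadratic_form_singleton_support[OF finM y diag off le that(1) s(1)] y[OF that(1)] s(2) that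
    by force
  have xs: "x v = y s * c s v" for v
  proof -
    have "x v = (\<Sum>t\<in>{s}. y t * c t v)"
      unfolding x_def using finM s(1) zero by (intro sum.mono_neutral_right) auto
    then show ?thesis by simp
  qed
  \<comment> \<open>At a vertex of \<open>snd s - fst s\<close> the function \<open>x\<close> takes
    the value \<open>y s > 0\<close>.\<close>
  obtain v where v: "v \<in> snd s" "v \<notin> fst s"
    using tangle_not_subset[OF wf_digraph_axioms assms(3) M_tau[OF s(1)]] by blast
  then have "0 < x v" using s(2) by (simp add: xs c_def)
  then show False using x sub(2)[OF s(1)] v(1) by force
qed

section \<open>From duality to the weight function\<close>

theorem theorem1:
  fixes G :: "('a, 'b) pre_digraph"
    and k :: int
    and \<tau> :: "('a set \<times> 'a set) set"
  assumes "graph G"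
    and "tangle G k \<tau>"
  shows "\<exists>w :: 'a \<Rightarrow> nat. \<forall>A B. separation G A B \<and> int (sep_order A B) < k \<longrightarrow>
           ((A, B) \<in> \<tau> \<longleftrightarrow> (\<Sum>u\<in>A. w u) < (\<Sum>u\<in>B. w u))"
proof -
  interpret graph G by fact
  let ?M = "maximal_seps \<tau>" and ?V = "verts G"
  define c where "c = (\<lambda>(s :: 'a set \<times> 'a set) v. indicator (snd s) v - indicator (fst s) v :: real)"
  \<comment> \<open>The coefficients may vanish, so that each \<open>c s\<close> itself lies in
    \<open>C\<close>, but not all at once, since the zero function has no positive value.\<close>
  define K where "K = {y :: 'a set \<times> 'a set \<Rightarrow> real. (\<forall>s\<in>?M. 0 \<le> y s) \<and> (\<exists>s\<in>?M. 0 < y s)}"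
  define C where "C = (\<lambda>y v. \<Sum>s\<in>?M. y s * c s v) ` K"
  have C_I: "(\<lambda>v. \<Sum>s\<in>?M. y s * c s v) \<in> C" if "y \<in> K" for y
    unfolding C_def using that by (rule imageI)
  have sub: "A \<subseteq> ?V \<and> B \<subseteq> ?V" if "(A, B) \<in> \<tau>" for A B
    using tangleD(1)[OF assms(2) that] by (auto simp: separation_def)
  have "?M \<subseteq> Pow ?V \<times> Pow ?V"
    using sub by (auto simp: maximal_seps_def)
  then have finM: "finite ?M"
    by (rule finite_subset) simp
  have "\<exists>w. (\<forall>v\<in>?V. 0 \<le> w v) \<and> (\<forall>r\<in>c ` ?M. 0 < (\<Sum>v\<in>?V. w v * r v))"
  proof (rule positive_solution_exists)
    show "c ` ?M \<subseteq> C"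
    proof (rule image_subsetI)
      fix s assume s: "s \<in> ?M"
      let ?y = "\<lambda>t. of_bool (t = s) :: real"
      have "c s v = (\<Sum>t\<in>?M. ?y t * c t v)" for v
      proof -
        have "(\<Sum>t\<in>?M. ?y t * c t v) = (\<Sum>t\<in>{s}. ?y t * c t v)"
          using finM s by (intro sum.mono_neutral_right) auto
        then show ?thesis by simp
      qed
      then have "c s = (\<lambda>v. \<Sum>t\<in>?M. ?y t * c t v)" by (rule ext)
      also have "\<dots> \<in> C" using s by (intro C_I) (auto simp: K_def)
      finally show "c s \<in> C" .
    qed
    show "(\<lambda>v. x v + x' v) \<in> C" if xC: "x \<in> C" "x' \<in> C" for x x'
    proof -
      obtain y y' where y: "y \<in> K" "y' \<in> K"
        and x: "x = (\<lambda>v. \<Sum>s\<in>?M. y s * c s v)" "x' = (\<lambda>v. \<Sum>s\<in>?M. y' s * c s v)"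
        using xC by (auto simp: C_def)
      have "(\<lambda>v. x v + x' v) = (\<lambda>v. \<Sum>s\<in>?M. (y s + y' s) * c s v)"
        by (simp add: x sum.distrib distrib_right)
      also have "\<dots> \<in> C"
        using y by (intro C_I) (auto simp: K_def intro: add_pos_nonneg)
      finally show ?thesis .
    qed
    show "(\<lambda>v. a * x v) \<in> C" if a: "0 < a" and xC: "x \<in> C" for a x
    proof -
      obtain y where y: "y \<in> K" and x: "x = (\<lambda>v. \<Sum>s\<in>?M. y s * c s v)"
        using xC by (auto simp: C_def)
      have "(\<lambda>v. a * x v) = (\<lambda>v. \<Sum>s\<in>?M. (a * y s) * c s v)"
        by (simp add: x sum_distrib_left mult.assoc)
      also have "\<dots> \<in> C"
        using y a by (intro C_I) (fastforce simp: K_def zero_le_mult_iff zero_less_mult_iff)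
      finally show ?thesis .
    qed
    show "\<exists>v\<in>?V. 0 < x v" if xC: "x \<in> C" for x
    proof -
      obtain y where y: "y \<in> K" and x: "x = (\<lambda>v. \<Sum>s\<in>?M. y s * c s v)"
        using xC by (auto simp: C_def)
      show ?thesis
        unfolding x c_def using y by (intro maximal_seps_no_dual[OF assms _ _ finM]) (auto simp: K_def)
    qed
  qed (use finM in auto)
  then obtain w :: "'a \<Rightarrow> nat" where w: "\<forall>r\<in>c ` ?M. 0 < (\<Sum>v\<in>?V. real (w v) * r v)"
    using positive_solution_nat[of "c ` ?M" ?V] finM by blast
  have less: "sum w A < sum w B" if tau: "(A, B) \<in> \<tau>" for A B
  proof -
    obtain A' B' where M: "(A', B') \<in> ?M" and le: "A \<subseteq> A'" "B' \<subseteq> B"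
      using ex_maximal_sep[OF finite_verts sub tau] by blast
    have sub': "A' \<subseteq> ?V" "B' \<subseteq> ?V" using M sub by (auto simp: maximal_seps_def)
    have ind: "(\<Sum>v\<in>?V. real (w v) * indicator X v) = real (sum w X)" if "X \<subseteq> ?V" for X
      using that by (simp add: indicator_def if_distrib sum.If_cases Int_absorb1 cong: if_cong)
    have "0 < (\<Sum>v\<in>?V. real (w v) * c (A', B') v)" using w M by blast
    also have "\<dots> = real (sum w B') - real (sum w A')"
      by (simp only: c_def right_diff_distrib sum_subtractf ind[OF sub'(1)] ind[OF sub'(2)] fst_conv snd_conv)
    finally have "sum w A' < sum w B'" by linarith
    moreover have "sum w A \<le> sum w A'" "sum w B' \<le> sum w B"
      using le sub' sub[OF tau] finite_subset[OF _ finite_verts] by (auto intro!: sum_mono2)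
    ultimately show ?thesis by linarith
  qed
  show ?thesis
  proof (intro exI[of _ w] allI impI)
    fix A B assume "separation G A B \<and> int (sep_order A B) < k"
    then have "(A, B) \<in> \<tau> \<or> (B, A) \<in> \<tau>"
      using tangle_total[OF assms(2)] by blast
    \<comment> \<open>If \<open>(A, B)\<close> is not in the tangle, then \<open>(B, A)\<close> is,
      and \<open>less\<close> gives the opposite strict inequality.\<close>
    then show "(A, B) \<in> \<tau> \<longleftrightarrow> sum w A < sum w B"
      using less by fastforce
  qed
qed

end
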